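(* Let $p$ be a prime number, let $d$ and $\ell$ be positive integers with $\ell \le d$, and let $1 \le s_1 < s_2 < \cdots < s_\ell = d$ be positive integers. For each $1 \le i \le \ell$ and each $j$ with $1 \le j \le s_i - 1$ and $j \ne s_1,\ldots,s_{i-1}$, let $a_{ij}$ be an integer with $1 \le a_{ij} \le p-1$. For $1 \le i \le \ell$ and $0 \le j \le d$ define $g_{ij} \in \mathbb{R}/\mathbb{Z}$ by $$g_{ij} = \begin{cases} -\sum_{k=1}^d g_{ik}, & \text{if } j = 0,\\ \frac{p-a_{ij}}{p}, & \text{if } 1 \le j \le s_i-1 \text{ and } j \ne s_1,\ldots,s_{i-1},\\ \frac1p, & \text{if } j = s_i,\\ 0, & \text{otherwise.}\end{cases}$$ Suppose that there exists an integer $r$ with $d = rp-1$, and that for each $1 \le j \le d-1$ with $j \ne s_1,\ldots,s_\ell$ there exists a positive integer $t_j$ such that $\sum_{i} a_{ij} = t_j p - 1$, where the sum is over all $i$ with $1\le i\le \ell$ and $s_i > j$. If $\Delta \subset \mathbb{R}^d$ is a $d$-dimensional lattice simplex such that $\Lambda_\Delta$ is generated by $(g_{10},\ldots,g_{1d}),\ldots,(g_{\ell 0},\ldots,g_{\ell d})$, then $\Delta$ is Gorenstein of index $r$ and $\mathrm{Vol}(\Delta) = p^\ell$.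
   Context: A lattice polytope is a convex polytope all of whose vertices have integer coordinates. The normalized volume $\mathrm{Vol}(\mathcal{P})$ of a $d$-dimensional lattice polytope $\mathcal{P}\subset\mathbb{R}^d$ is $d!$ times its Euclidean volume. For a $d$-dimensional lattice simplex $\Delta \subset \mathbb{R}^d$ with (ordered) vertices $v_0,\ldots,v_d \in \mathbb{Z}^d$, define the finite abelian group $$\Lambda_\Delta = \{(\lambda_0,\ldots,\lambda_d) \in (\mathbb{R}/\mathbb{Z})^{d+1} : \textstyle\sum_{i=0}^d \lambda_i (v_i,1) \in \mathbb{Z}^{d+1}\}$$ with componentwise addition. A $d$-dimensional lattice polytope $\mathcal{Q} \subset \mathbb{R}^d$ is reflexive if the origin is the unique lattice point in its interior and its dual polytope $\mathcal{Q}^\vee = \{y \in \mathbb{R}^d : \langle x,y\rangle \le 1 \text{ for all } x \in \mathcal{Q}\}$ is also a lattice polytope. A $d$-dimensional lattice polytope $\mathcal{P} \subset \mathbb{R}^d$ is Gorenstein of index $r$ ($r \in \mathbb{Z}_{>0}$) if there exist a reflexive polytope $\mathcal{Q} \subset \mathbb{R}^d$ and $w \in \mathbb{Z}^d$ with $\mathcal{Q} = r\mathcal{P} + w$. *)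

theory Defs
  imports "HOL-Analysis.Analysis" "HOL-Algebra.Product_Groups"
begin

definition int_lattice :: "(real ^ 'n) set" where
  "int_lattice = {x. \<forall>k. x $ k \<in> \<int>}"

definition lattice_polytope :: "(real ^ 'n) set \<Rightarrow> bool" where
  "lattice_polytope P \<longleftrightarrow> polytope P \<and> {x. x extreme_point_of P} \<subseteq> int_lattice"

definition full_dim_lattice_polytope :: "(real ^ 'n) set \<Rightarrow> bool" where
  "full_dim_lattice_polytope P \<longleftrightarrow> lattice_polytope P \<and> aff_dim P = int CARD('n)"

definition full_dim_lattice_simplex :: "(real ^ 'n) set \<Rightarrow> bool" where
  "full_dim_lattice_simplex P \<longleftrightarrow> lattice_polytope P \<and> int CARD('n) simplex P"

definition ordered_vertices :: "(nat \<Rightarrow> real ^ 'n) \<Rightarrow> (real ^ 'n) set \<Rightarrow> bool" where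
  "ordered_vertices v P \<longleftrightarrow> bij_betw v {0..CARD('n)} {x. x extreme_point_of P}"

definition normalized_volume :: "(real ^ 'n) set \<Rightarrow> real" where
  "normalized_volume P = fact CARD('n) * measure lebesgue P"

definition dual_polytope :: "(real ^ 'n) set \<Rightarrow> (real ^ 'n) set" where
  "dual_polytope Q = {y. \<forall>x\<in>Q. x \<bullet> y \<le> 1}"

definition reflexive_polytope :: "(real ^ 'n) set \<Rightarrow> bool" where
  "reflexive_polytope Q \<longleftrightarrow> full_dim_lattice_polytope Q \<and>
     interior Q \<inter> int_lattice = {0} \<and> lattice_polytope (dual_polytope Q)"

definition gorenstein_of_index :: "int \<Rightarrow> (real ^ 'n) set \<Rightarrow> bool" where
  "gorenstein_of_index r P \<longleftrightarrow> r > 0 \<and> full_dim_lattice_polytope P \<and>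
     (\<exists>Q w. reflexive_polytope Q \<and> w \<in> int_lattice \<and> Q = (\<lambda>x. of_int r *\<^sub>R x + w) ` P)"

quotient_type real_mod_int = real / "\<lambda>x y. x - y \<in> \<int>"
  morphisms rep_real_mod_int real_mod_int
proof (rule equivpI)
  show "reflp (\<lambda>x y::real. x - y \<in> \<int>)"
    by (rule reflpI) simp
  show "symp (\<lambda>x y::real. x - y \<in> \<int>)"
    by (rule sympI) (metis Ints_minus minus_diff_eq)
  show "transp (\<lambda>x y::real. x - y \<in> \<int>)"
    by (rule transpI) (metis Ints_add diff_add_cancel add_diff_eq)
qed

instantiation real_mod_int :: ab_group_add
begin

lift_definition zero_real_mod_int :: real_mod_int is 0 .

lift_definition plus_real_mod_int :: "real_mod_int \<Rightarrow> real_mod_int \<Rightarrow> real_mod_int" is "(+)"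
  by (metis Ints_add add_diff_add)

lift_definition uminus_real_mod_int :: "real_mod_int \<Rightarrow> real_mod_int" is uminus
  by (metis Ints_minus minus_diff_minus)

lift_definition minus_real_mod_int :: "real_mod_int \<Rightarrow> real_mod_int \<Rightarrow> real_mod_int" is "(-)"
  by (metis Ints_diff diff_diff_eq diff_diff_eq2 diff_add_eq add.commute)

instance
  by standard (transfer; simp add: algebra_simps)+

end

definition real_mod_int_group :: "real_mod_int monoid" where
  "real_mod_int_group = \<lparr>carrier = UNIV, monoid.mult = (+), one = 0\<rparr>"

text \<open>
  Elements of the (d+1)-fold product of \<open>\<real>/\<int>\<close> are extensional functions on \<open>{0..d}\<close>, as in
  \<^const>\<open>product_group\<close>. Membership in the carrier is expressed through a choice \<open>x\<close> of real
  representatives; as the points \<open>v i\<close> are lattice points, the choice is irrelevant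
  (see \<open>Lambda_group_representatives\<close>).
\<close>

definition Lambda_group :: "(nat \<Rightarrow> real ^ 'n) \<Rightarrow> (nat \<Rightarrow> real_mod_int) monoid" where
  "Lambda_group v = (product_group {0..CARD('n)} (\<lambda>_. real_mod_int_group))
     \<lparr>carrier := {l \<in> {0..CARD('n)} \<rightarrow>\<^sub>E UNIV. \<exists>x :: nat \<Rightarrow> real.
        (\<forall>i\<in>{0..CARD('n)}. l i = real_mod_int (x i)) \<and>
        (\<Sum>i=0..CARD('n). x i *\<^sub>R (v i, 1 :: real)) \<in> int_lattice \<times> \<int>}\<rparr>"

lemma int_lattice_sum:
  assumes "\<And>i. i \<in> A \<Longrightarrow> f i \<in> int_lattice"
  shows "sum f A \<in> int_lattice"
  using assms by (auto simp: int_lattice_def intro!: Ints_sum)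

lemma Lambda_group_representatives:
  fixes v :: "nat \<Rightarrow> real ^ 'n"
  assumes v: "\<And>i. i \<le> CARD('n) \<Longrightarrow> v i \<in> int_lattice"
    and xy: "\<And>i. i \<le> CARD('n) \<Longrightarrow> real_mod_int (x i) = real_mod_int (y i)"
    and x: "(\<Sum>i=0..CARD('n). x i *\<^sub>R (v i, 1 :: real)) \<in> int_lattice \<times> \<int>"
  shows "(\<Sum>i=0..CARD('n). y i *\<^sub>R (v i, 1 :: real)) \<in> int_lattice \<times> \<int>"
proof -
  let ?A = "{0..CARD('n)}"
  have Z: "y i - x i \<in> \<int>" if "i \<in> ?A" for i
    using xy[of i] that by (metis real_mod_int.abs_eq_iff atLeastAtMost_iff)
  have "(\<Sum>i\<in>?A. (y i - x i) *\<^sub>R v i) \<in> int_lattice"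
    using Z v by (intro int_lattice_sum) (auto simp: int_lattice_def)
  moreover have "(\<Sum>i\<in>?A. y i - x i) \<in> \<int>"
    using Z by (intro Ints_sum) auto
  moreover have "(\<Sum>i\<in>?A. x i *\<^sub>R v i) \<in> int_lattice" "(\<Sum>i\<in>?A. x i) \<in> \<int>"
    using x by (simp_all add: sum_prod)
  ultimately have "(\<Sum>i\<in>?A. (y i - x i) *\<^sub>R v i) + (\<Sum>i\<in>?A. x i *\<^sub>R v i) \<in> int_lattice"
    and "(\<Sum>i\<in>?A. y i - x i) + (\<Sum>i\<in>?A. x i) \<in> \<int>"
    by (auto simp: int_lattice_def simp del: sum_component)
  then show ?thesis
    by (simp add: sum_prod flip: sum.distrib scaleR_add_left)
qed

text \<open>
  The entries with \<open>j \<ge> 1\<close> come first, since the entry at \<open>j = 0\<close> is defined from them.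
\<close>

definition gen_entry :: "nat \<Rightarrow> (nat \<Rightarrow> nat) \<Rightarrow> (nat \<Rightarrow> nat \<Rightarrow> int) \<Rightarrow> nat \<Rightarrow> nat \<Rightarrow> real_mod_int" where
  "gen_entry p s a i j =
     (if 1 \<le> j \<and> j \<le> s i - 1 \<and> j \<notin> s ` {1..<i} then real_mod_int ((real p - of_int (a i j)) / real p)
      else if j = s i then real_mod_int (1 / real p)
      else 0)"

definition gen :: "nat \<Rightarrow> nat \<Rightarrow> (nat \<Rightarrow> nat) \<Rightarrow> (nat \<Rightarrow> nat \<Rightarrow> int) \<Rightarrow> nat \<Rightarrow> nat \<Rightarrow> real_mod_int" where
  "gen d p s a i = (\<lambda>j\<in>{0..d}. if j = 0 then - (\<Sum>k=1..d. gen_entry p s a i k) else gen_entry p s a i j)"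

end

theory Submission imports Defs begin

text \<open>
  Move \<open>v 0\<close> to the origin and let \<open>W\<close> be the matrix with columns \<open>v j - v 0\<close>, so that \<open>\<Delta>\<close> is the image of
  the standard simplex under \<open>x \<mapsto> v 0 + W x\<close>. The proof takes place in the coordinates \<open>x\<close>, in the lattice
  \<open>M = {x. W x \<in> \<int>\<^sup>d}\<close>, which contains \<open>\<int>\<^sup>d\<close>. A tuple in the group \<open>\<Lambda>\<close> of \<open>\<Delta>\<close> is determined by its entries
  with index at least 1, since all entries sum to an integer, and these entries form exactly a point
  of \<open>M / \<int>\<^sup>d\<close>. Hence the hypothesis on generators says that \<open>M\<close> is spanned by \<open>\<int>\<^sup>d\<close> and real lifts
  \<open>G 1, \<dots>, G l\<close> of the given generators (\<open>edge_lattice_eq_generated\<close>).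

  \<^emph>\<open>Gorenstein.\<close> Every \<open>p G i\<close> is integral, so \<open>p M \<subseteq> \<int>\<^sup>d\<close>: the functions \<open>p x\<^sub>j\<close> are integral on \<open>M\<close>. The
  assumptions on the column sums of the \<open>a i j\<close> ensure that \<open>G 1 + \<dots> + G l\<close> is congruent to
  \<open>(1/p, \<dots>, 1/p)\<close> modulo \<open>\<int>\<^sup>d\<close> (\<open>sum_gen_lift\<close>), so this point lies in \<open>M\<close>. As \<open>d + 1 = r p\<close>, it gives the
  lattice point of \<open>r \<Delta>\<close> all of whose \<open>d + 1\<close> barycentric weights are equal to \<open>1/p\<close>. After this point is
  moved to the origin, \<open>r \<Delta>\<close> is cut out by inequalities \<open>h \<ge> -1\<close> with \<open>d + 1\<close> integral linear
  functions \<open>h\<close>; therefore the dual has integral vertices, and the origin is the only interior lattice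
  point because the functions \<open>h\<close> sum to 0 (\<open>gorenstein_of_index_affine_image\<close>).

  \<^emph>\<open>Volume.\<close> At the positions \<open>s 1, \<dots>, s l\<close> the lifts restrict to \<open>1/p\<close> times the identity matrix.
  So a basis of \<open>M\<close> arises from the standard basis when the vectors at these positions are replaced by
  \<open>G 1, \<dots>, G l\<close>, and this basis has determinant \<open>p\<close> to the power \<open>-l\<close> up to sign. Since \<open>W\<close> maps \<open>M\<close>
  onto \<open>\<int>\<^sup>d\<close>, the absolute value of \<open>det W\<close> is \<open>p\<close> to the power \<open>l\<close> (\<open>abs_det_eq_lattice_index\<close>), and
  it is also the normalized volume of \<open>\<Delta>\<close> (\<open>content_simplex_vertices\<close>).
\<close>

section \<open>Integer matrices and the index of a lattice\<close>

definition integer_matrix :: "real ^ 'm ^ 'n \<Rightarrow> bool" where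
  "integer_matrix A \<longleftrightarrow> (\<forall>i j. A $ i $ j \<in> \<int>)"

lemma int_lattice_add: "x \<in> int_lattice \<Longrightarrow> y \<in> int_lattice \<Longrightarrow> x + y \<in> int_lattice"
  and int_lattice_diff: "x \<in> int_lattice \<Longrightarrow> y \<in> int_lattice \<Longrightarrow> x - y \<in> int_lattice"
  and int_lattice_minus: "x \<in> int_lattice \<Longrightarrow> - x \<in> int_lattice"
  and int_lattice_scaleR: "c \<in> \<int> \<Longrightarrow> x \<in> int_lattice \<Longrightarrow> c *\<^sub>R x \<in> int_lattice"
  and int_lattice_0: "0 \<in> int_lattice"
  and int_lattice_axis: "axis i 1 \<in> int_lattice"
  by (auto simp: int_lattice_def axis_def)

lemma integer_matrix_iff:
  "integer_matrix A \<longleftrightarrow> (\<forall>x\<in>int_lattice. A *v x \<in> int_lattice)"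
proof
  assume "integer_matrix A"
  then show "\<forall>x\<in>int_lattice. A *v x \<in> int_lattice"
    by (auto simp: integer_matrix_def int_lattice_def matrix_vector_mult_def intro!: Ints_sum)
next
  assume *: "\<forall>x\<in>int_lattice. A *v x \<in> int_lattice"
  have "column j A \<in> int_lattice" for j
    using * int_lattice_axis[of j] by (metis matrix_vector_mult_basis)
  then show "integer_matrix A"
    by (simp add: integer_matrix_def int_lattice_def column_def)
qed

lemma integer_matrix_columns:
  "integer_matrix A \<longleftrightarrow> (\<forall>j. A *v axis j 1 \<in> int_lattice)"
  by (auto simp: integer_matrix_def int_lattice_def matrix_vector_mult_basis column_def)

lemma integer_matrix_transpose: "integer_matrix A \<Longrightarrow> integer_matrix (transpose A)"
  by (simp add: integer_matrix_def transpose_def)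

lemma det_integer_matrix: "integer_matrix A \<Longrightarrow> det A \<in> \<int>"
  by (auto simp: integer_matrix_def det_def intro!: Ints_sum Ints_mult Ints_prod)

text \<open>
  The determinants of \<open>A\<close> and of its inverse are integers with product 1.
\<close>

lemma abs_det_unimodular:
  fixes A B :: "real ^ 'n ^ 'n"
  assumes "integer_matrix A" "integer_matrix B" "A ** B = mat 1"
  shows "\<bar>det A\<bar> = 1"
proof -
  obtain m k :: int where mk: "det A = of_int m" "det B = of_int k"
    using assms(1,2) det_integer_matrix by (metis Ints_cases)
  have "det A * det B = 1"
    using assms(3) by (metis det_I det_mul)
  then have "m * k = 1"
    unfolding mk by (metis of_int_eq_1_iff of_int_mult)
  then have "\<bar>m\<bar> = 1"
    using zmult_eq_1_iff by auto
  then show ?thesis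
    using mk by simp
qed

text \<open>
  The index of \<open>\<int>\<^sup>d\<close> in the lattice \<open>{x. W *v x \<in> int_lattice}\<close> is the absolute value of \<open>det W\<close>. It can be
  read off from generators \<open>g j\<close> that are \<open>1/p\<close> times a unit vector on the coordinates in \<open>S\<close>: each of them
  contributes a factor \<open>p\<close>, since a basis \<open>J\<close> of the lattice with determinant \<open>p\<close> to the power \<open>- card S\<close>, up to sign,
  makes \<open>W ** J\<close> unimodular.
\<close>

lemma abs_det_eq_lattice_index:
  fixes W :: "real ^ 'n ^ 'n" and g :: "'n \<Rightarrow> real ^ 'n" and S :: "'n set" and p :: nat
  assumes "p > 0" "invertible W" "integer_matrix W"
    and g_mem: "\<And>j. j \<in> S \<Longrightarrow> W *v g j \<in> int_lattice"
    and g_int: "\<And>j. j \<in> S \<Longrightarrow> real p *\<^sub>R g j \<in> int_lattice"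
    and g_diag: "\<And>j k. j \<in> S \<Longrightarrow> k \<in> S \<Longrightarrow> g j $ k = (if k = j then 1 / p else 0)"
    and gen: "\<And>x. W *v x \<in> int_lattice \<Longrightarrow>
        \<exists>c :: 'n \<Rightarrow> int. x - (\<Sum>j\<in>S. of_int (c j) *\<^sub>R g j) \<in> int_lattice"
  shows "\<bar>det W\<bar> = real p ^ card S"
proof -
  \<comment> \<open>\<open>J\<close> has the columns \<open>g j\<close> for \<open>j \<in> S\<close> and \<open>axis j 1\<close> otherwise: a basis of \<open>{x. W *v x \<in> int_lattice}\<close>.
      Splitting off the diagonal part \<open>D\<close> leaves \<open>mat 1 + N\<close>, which is unimodular because \<open>N\<close> squares to 0;
      \<open>K\<close> is the inverse of \<open>J\<close>.\<close>
  define N :: "real ^ 'n ^ 'n" where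
    "N = (\<chi> k j. if j \<in> S \<and> k \<notin> S then real p * g j $ k else 0)"
  define D :: "real ^ 'n ^ 'n" where "D = (\<chi> k j. if j = k then if k \<in> S then 1 / p else 1 else 0)"
  define E :: "real ^ 'n ^ 'n" where "E = (\<chi> k j. if j = k then if k \<in> S then real p else 1 else 0)"
  define J where "J = (mat 1 + N) ** D"
  define K where "K = E ** (mat 1 - N)"
  have N_app: "(N *v x) $ k = (if k \<in> S then 0 else \<Sum>j\<in>S. real p * g j $ k * x $ j)" for x k
    by (auto simp: N_def matrix_vector_mult_def intro!: sum.mono_neutral_cong_right)
  have D_app: "(D *v x) $ k = (if k \<in> S then 1 / p else 1) * x $ k" for x k
    unfolding D_def matrix_vector_mult_def by (simp add: if_distrib[of "\<lambda>t. t * _"] cong: if_cong)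
  have E_app: "(E *v x) $ k = (if k \<in> S then real p else 1) * x $ k" for x k
    unfolding E_def matrix_vector_mult_def by (simp add: if_distrib[of "\<lambda>t. t * _"] cong: if_cong)
  have J_app: "J *v x = D *v x + N *v (D *v x)" for x
    by (simp add: J_def matrix_vector_mul_assoc[symmetric] matrix_vector_mult_add_rdistrib)
  have K_app: "K *v x = E *v (x - N *v x)" for x
    by (simp add: K_def matrix_vector_mul_assoc[symmetric] matrix_vector_mult_diff_rdistrib)
  have Nint: "integer_matrix N"
    using g_int by (auto simp: N_def integer_matrix_def int_lattice_def)
  have NN: "N *v (N *v x) = 0" for x
    by (simp add: vec_eq_iff N_app)
  have inv1: "(mat 1 + N) ** (mat 1 - N) = mat 1"
    by (simp add: matrix_eq NN matrix_vector_mul_assoc[symmetric] matrix_vector_mult_diff_rdistrib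
        matrix_vector_mult_add_rdistrib matrix_vector_mult_diff_distrib)
  have DE: "D *v (E *v x) = x" for x
    using \<open>p > 0\<close> by (simp add: vec_eq_iff D_app E_app)
  have JK: "J ** K = mat 1"
    by (simp add: matrix_eq matrix_vector_mul_assoc[symmetric] J_app K_app DE NN
        matrix_vector_mult_diff_distrib)
  then have JK': "J *v (K *v x) = x" for x
    by (simp add: matrix_vector_mul_assoc)
  have detJ: "\<bar>det J\<bar> = (1 / real p) ^ card S"
  proof -
    have "\<bar>det (mat 1 + N)\<bar> = 1"
      using Nint inv1 by (intro abs_det_unimodular[of _ "mat 1 - N"])
        (auto simp: integer_matrix_def mat_def)
    moreover have "det D = (\<Prod>j\<in>UNIV. if j \<in> S then 1 / real p else 1)"
      by (subst det_diagonal) (auto simp: D_def)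
    moreover have "\<dots> = (1 / real p) ^ card S"
      by (subst prod.inter_restrict[symmetric, of UNIV, simplified]) auto
    ultimately show ?thesis
      unfolding J_def by (simp add: det_mul abs_mult)
  qed
  have WJ: "integer_matrix (W ** J)"
    unfolding integer_matrix_columns
  proof
    fix j
    have "J *v axis j 1 = (if j \<in> S then g j else axis j 1)"
    proof -
      have D_axis: "D *v axis j 1 = (if j \<in> S then 1 / real p else 1) *\<^sub>R axis j 1"
        by (auto simp: vec_eq_iff D_app axis_def)
      have "(N *v axis j 1) $ k = (if j \<in> S \<and> k \<notin> S then real p * g j $ k else 0)" for k
        by (simp add: matrix_vector_mult_basis column_def N_def)
      then show ?thesis
        using \<open>p > 0\<close> g_diag[of j]
        unfolding J_app D_axis matrix_vector_mult_scaleR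
        by (simp add: vec_eq_iff) (auto simp: axis_def)
    qed
    moreover have "W *v axis j 1 \<in> int_lattice"
      using assms(3) integer_matrix_columns by blast
    ultimately show "(W ** J) *v axis j 1 \<in> int_lattice"
      unfolding matrix_vector_mul_assoc[symmetric] using g_mem by auto
  qed
  \<comment> \<open>Integrality of \<open>K\<close> on the whole lattice is checked on its generators.\<close>
  have K_mem: "K *v x \<in> int_lattice" if x: "W *v x \<in> int_lattice" for x
  proof -
    have K_g: "K *v g j \<in> int_lattice" if j: "j \<in> S" for j
    proof -
      have "(N *v g j) $ k = (if k \<in> S then 0 else g j $ k)" for k
      proof (cases "k \<in> S")
        case False
        have "(N *v g j) $ k = (\<Sum>m\<in>S. real p * g m $ k * (if m = j then 1 / p else 0))"
          using False j by (simp add: N_app g_diag)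
        also have "\<dots> = g j $ k"
          using j \<open>p > 0\<close> by (simp add: if_distrib[of "\<lambda>t. _ * t"] cong: if_cong)
        finally show ?thesis using False by simp
      qed (simp add: N_app)
      then have "(K *v g j) $ k = (if k = j then 1 else 0)" for k
        using j \<open>p > 0\<close> g_diag[OF j] by (simp add: K_app E_app)
      then show ?thesis by (simp add: int_lattice_def)
    qed
    \<comment> \<open>On \<open>\<int>\<^sup>d\<close> it holds because \<open>N\<close> and the inverse \<open>E\<close> of \<open>D\<close> have integer entries.\<close>
    have K_Z: "K *v y \<in> int_lattice" if y: "y \<in> int_lattice" for y
    proof -
      have "y - N *v y \<in> int_lattice"
        using y Nint integer_matrix_iff int_lattice_diff by blast
      then show ?thesis
        unfolding K_app by (auto simp: int_lattice_def E_app)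
    qed
    obtain c :: "'n \<Rightarrow> int" where
      c: "x - (\<Sum>j\<in>S. of_int (c j) *\<^sub>R g j) \<in> int_lattice"
      using gen[OF x] by blast
    have "K *v x = K *v (x - (\<Sum>j\<in>S. of_int (c j) *\<^sub>R g j)) + (\<Sum>j\<in>S. of_int (c j) *\<^sub>R (K *v g j))"
      by (simp add: linear_sum[OF matrix_vector_mul_linear] matrix_vector_mult_diff_distrib
          matrix_vector_mult_scaleR)
    moreover have "(\<Sum>j\<in>S. of_int (c j) *\<^sub>R (K *v g j)) \<in> int_lattice"
      using K_g by (intro int_lattice_sum int_lattice_scaleR) auto
    ultimately show ?thesis
      using K_Z[OF c] int_lattice_add by metis
  qed
  obtain V where "W ** V = mat 1"
    using assms(2) invertible_right_inverse by blast
  then have WV: "W *v (V *v x) = x" for x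
    by (simp add: matrix_vector_mul_assoc)
  have "integer_matrix (K ** V)"
    unfolding integer_matrix_iff matrix_vector_mul_assoc[symmetric]
    by (auto intro!: K_mem simp: WV)
  moreover have "(W ** J) ** (K ** V) = mat 1"
    by (simp add: matrix_eq matrix_vector_mul_assoc[symmetric] JK' WV)
  ultimately have "\<bar>det (W ** J)\<bar> = 1"
    using WJ abs_det_unimodular by blast
  then have "\<bar>det W\<bar> * (1 / real p) ^ card S = 1"
    by (simp add: det_mul abs_mult detJ)
  then show ?thesis
    using \<open>p > 0\<close> by (simp add: power_one_over field_simps)
qed

section \<open>Convex hulls, interiors and the standard simplex\<close>

lemma bij_betw_axis_Basis: "bij_betw (\<lambda>i::'n::finite. axis i (1::real)) UNIV Basis"
  by (auto simp: bij_betw_def inj_def axis_eq_axis Basis_vec_def)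

lemma lattice_polytope_convex_hull:
  assumes "finite X" "X \<subseteq> int_lattice"
  shows "lattice_polytope (convex hull X)"
  using assms extreme_points_of_convex_hull
  unfolding lattice_polytope_def polytope_def by blast

lemma convex_hull_affine_image:
  assumes "linear L"
  shows "(\<lambda>x. a + L x) ` (convex hull X) = convex hull ((\<lambda>x. a + L x) ` X)"
proof -
  have "(\<lambda>x. a + L x) ` Y = (+) a ` L ` Y" for Y
    by (auto simp: image_image)
  then show ?thesis
    by (simp add: convex_hull_translation convex_hull_linear_image[OF assms])
qed

lemma interior_affine_image:
  fixes L :: "'a::euclidean_space \<Rightarrow> 'a"
  assumes "linear L" "inj L"
  shows "interior ((\<lambda>x. a + L x) ` S) = (\<lambda>x. a + L x) ` interior S"
proof -
  have "(\<lambda>x. a + L x) ` Y = (+) a ` L ` Y" for Y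
    by (auto simp: image_image)
  then show ?thesis
    by (simp add: interior_translation interior_injective_linear_image[OF assms])
qed

lemma full_dim_if_interior:
  fixes P :: "(real ^ 'n) set"
  assumes "lattice_polytope P" "interior P \<noteq> {}"
  shows "full_dim_lattice_polytope P"
  using assms by (simp add: full_dim_lattice_polytope_def aff_dim_nonempty_interior)

lemma ball_Basis_cart: "(\<forall>b\<in>Basis. Q b) \<longleftrightarrow> (\<forall>i. Q (axis i 1))" for Q :: "real ^ 'n \<Rightarrow> bool"
  by (auto simp: Basis_vec_def)

lemma sum_Basis_cart: "(\<Sum>b\<in>Basis. x \<bullet> b) = (\<Sum>i\<in>UNIV. x $ i)" for x :: "real ^ 'n"
  by (subst sum.reindex_bij_betw[OF bij_betw_axis_Basis, symmetric]) (simp add: inner_axis)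

lemma mem_std_simplex_cart:
  fixes x :: "real ^ 'n"
  shows "x \<in> convex hull (insert 0 Basis) \<longleftrightarrow> (\<forall>i. 0 \<le> x $ i) \<and> (\<Sum>i\<in>UNIV. x $ i) \<le> 1"
    and "x \<in> interior (convex hull (insert 0 Basis)) \<longleftrightarrow> (\<forall>i. 0 < x $ i) \<and> (\<Sum>i\<in>UNIV. x $ i) < 1"
  unfolding interior_std_simplex by (simp_all add: std_simplex ball_Basis_cart sum_Basis_cart inner_axis)

section \<open>The volume of a simplex\<close>

text \<open>
  The determinant formula \<open>content_simplex\<close> is about coordinates indexed by a well-ordered type. An
  arbitrary finite index type comes without an order, so its coordinates are renamed to a copy of the
  type that is ordered by an enumeration; neither determinants nor volumes notice this.
\<close>

typedef 'a well_ordered_copy = "UNIV :: 'a set" by simp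

instantiation well_ordered_copy :: (finite) "{finite, wellorder}"
begin

definition less_eq_well_ordered_copy :: "'a well_ordered_copy \<Rightarrow> 'a well_ordered_copy \<Rightarrow> bool" where
  "x \<le> y \<longleftrightarrow> to_nat (Rep_well_ordered_copy x) \<le> to_nat (Rep_well_ordered_copy y)"

definition less_well_ordered_copy :: "'a well_ordered_copy \<Rightarrow> 'a well_ordered_copy \<Rightarrow> bool" where
  "x < y \<longleftrightarrow> to_nat (Rep_well_ordered_copy x) < to_nat (Rep_well_ordered_copy y)"

instance
proof
  have "range Abs_well_ordered_copy = (UNIV :: 'a well_ordered_copy set)"
    by (metis Rep_well_ordered_copy_inverse surjI)
  then show "finite (UNIV :: 'a well_ordered_copy set)"
    by (metis finite finite_imageI)
next
  fix P and x :: "'a well_ordered_copy"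
  assume *: "\<And>x :: 'a well_ordered_copy. (\<And>y. y < x \<Longrightarrow> P y) \<Longrightarrow> P x"
  show "P x"
    by (induction "to_nat (Rep_well_ordered_copy x)" arbitrary: x rule: less_induct)
      (use * less_well_ordered_copy_def in blast)
qed (auto simp: less_eq_well_ordered_copy_def less_well_ordered_copy_def
      Rep_well_ordered_copy_inject)

end

lemma bij_Rep_well_ordered_copy: "bij Rep_well_ordered_copy"
  by (metis Abs_well_ordered_copy_inverse Rep_well_ordered_copy_inverse UNIV_I bijI')

text \<open>
  Conjugation with \<open>f\<close> matches the permutations of both index types and preserves signs.
\<close>

lemma det_reindex:
  fixes A :: "'a::comm_ring_1 ^ 'n ^ 'n" and f :: "'m::finite \<Rightarrow> 'n"
  assumes f: "bij f"
  shows "det (\<chi> i j. A $ f i $ f j) = det A"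
proof -
  let ?map = "map_permutation UNIV f"
  have inj: "inj f" using f by (rule bij_is_inj)
  have bij: "bij_betw ?map {\<pi>. \<pi> permutes UNIV} {\<pi>. \<pi> permutes UNIV}"
  proof (rule bij_betw_byWitness[where f' = "map_permutation UNIV (inv_into UNIV f)"])
    show "\<forall>\<pi>\<in>{\<pi>. \<pi> permutes UNIV}. map_permutation UNIV (inv_into UNIV f) (?map \<pi>) = \<pi>"
      using map_permutation_compose_inv[OF f] inj by auto
    show "\<forall>\<pi>\<in>{\<pi>. \<pi> permutes UNIV}. ?map (map_permutation UNIV (inv_into UNIV f) \<pi>) = \<pi>"
      using map_permutation_compose_inv[OF bij_imp_bij_inv[OF f]] f
      by (auto simp: surj_f_inv_f bij_is_surj)
    show "?map ` {\<pi>. \<pi> permutes UNIV} \<subseteq> {\<pi>. \<pi> permutes UNIV}"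
      using map_permutation_permutes[OF f] by auto
    show "map_permutation UNIV (inv_into UNIV f) ` {\<pi>. \<pi> permutes UNIV} \<subseteq> {\<pi>. \<pi> permutes UNIV}"
      using map_permutation_permutes[OF bij_imp_bij_inv[OF f]] by auto
  qed
  have "(\<Prod>i\<in>UNIV. A $ i $ ?map \<pi> i) = (\<Prod>i\<in>UNIV. A $ f i $ f (\<pi> i))" for \<pi>
    by (subst prod.reindex_bij_betw[OF f, symmetric]) (simp add: map_permutation_apply inj)
  then show ?thesis
    unfolding det_def
    by (subst sum.reindex_bij_betw[OF bij, symmetric])
      (auto simp: sign_map_permutation inj intro!: sum.cong)
qed

lemma prod_Basis_cart: "(\<Prod>b\<in>Basis. x \<bullet> b) = (\<Prod>i\<in>UNIV. x $ i)" for x :: "real ^ 'n"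
  by (subst prod.reindex_bij_betw[OF bij_betw_axis_Basis, symmetric]) (simp add: inner_axis)

text \<open>
  Renaming coordinates carries boxes to boxes with the same side lengths, which determines
  Lebesgue measure.
\<close>

lemma measure_lborel_reindex:
  fixes f :: "'m::finite \<Rightarrow> 'n::finite" and S :: "(real ^ 'n) set"
  assumes f: "bij f" and S: "S \<in> sets borel"
  shows "measure lborel ((\<lambda>x. \<chi> i. x $ f i) ` S) = measure lborel S"
proof -
  define \<rho> :: "real ^ 'n \<Rightarrow> real ^ 'm" where "\<rho> x = (\<chi> i. x $ f i)" for x
  define \<sigma> :: "real ^ 'm \<Rightarrow> real ^ 'n" where "\<sigma> y = (\<chi> j. y $ inv_into UNIV f j)" for y
  have \<rho>\<sigma>: "\<rho> (\<sigma> y) = y" "\<sigma> (\<rho> x) = x" for x y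
    using f by (auto simp: \<rho>_def \<sigma>_def vec_eq_iff inv_f_f bij_is_inj surj_f_inv_f bij_is_surj)
  have "linear \<sigma>"
    by (auto simp: \<sigma>_def linear_iff vec_eq_iff)
  then have \<sigma>_meas [measurable]: "\<sigma> \<in> borel_measurable borel"
    by (simp add: borel_measurable_continuous_onI linear_continuous_on linear_conv_bounded_linear)
  have vimage: "\<sigma> -` T = \<rho> ` T" for T
    by (auto simp: image_iff) (metis \<rho>\<sigma>)+
  have "lborel = distr lborel borel \<sigma>"
  proof (rule lborel_eqI)
    fix l u :: "real ^ 'n"
    assume le: "\<And>b. b \<in> Basis \<Longrightarrow> l \<bullet> b \<le> u \<bullet> b"
    then have le': "l $ j \<le> u $ j" for j
      using le[of "axis j 1"] by (simp add: inner_axis)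
    have "\<sigma> -` box l u = box (\<rho> l) (\<rho> u)"
      using f unfolding vimage
      apply (auto simp: mem_box_cart \<rho>_def image_iff)
      subgoal for x by (rule bexI[of _ "\<sigma> x"]) (auto simp: \<sigma>_def vec_eq_iff mem_box_cart bij_is_inj  inv_f_f, (metis bij_inv_eq_iff)+)
      done
    then have "emeasure (distr lborel borel \<sigma>) (box l u) = emeasure lborel (box (\<rho> l) (\<rho> u))"
      by (simp add: emeasure_distr)
    also have "\<dots> = ennreal (\<Prod>b\<in>Basis. (\<rho> u - \<rho> l) \<bullet> b)"
      using le' by (intro emeasure_lborel_box) (auto simp: Basis_vec_def inner_axis \<rho>_def)
    also have "(\<Prod>b\<in>Basis. (\<rho> u - \<rho> l) \<bullet> b) = (\<Prod>i\<in>UNIV. (u - l) $ f i)"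
      by (subst prod_Basis_cart) (simp add: \<rho>_def)
    also have "\<dots> = (\<Prod>b\<in>Basis. (u - l) \<bullet> b)"
      by (subst prod.reindex_bij_betw[OF f]) (simp add: prod_Basis_cart)
    finally show "emeasure (distr lborel borel \<sigma>) (box l u) = (\<Prod>b\<in>Basis. (u - l) \<bullet> b)" .
  qed simp
  then have "measure lborel S = measure (distr lborel borel \<sigma>) S"
    by simp
  also have "\<dots> = measure lborel (\<rho> ` S)"
    using S by (subst measure_distr) (auto simp: vimage)
  finally show ?thesis
    by (simp add: \<rho>_def [abs_def])
qed

theorem content_simplex_vertices:
  fixes v :: "nat \<Rightarrow> real ^ 'n" and h :: "'n \<Rightarrow> nat"
  assumes h: "bij_betw h UNIV {1..CARD('n)}" and v: "inj_on v {0..CARD('n)}"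
  shows "measure lborel (convex hull (v ` {0..CARD('n)})) =
     \<bar>det (\<chi> k j. v (h j) $ k - v 0 $ k)\<bar> / fact CARD('n)"
proof -
  let ?Rep = "Rep_well_ordered_copy :: 'n well_ordered_copy \<Rightarrow> 'n"
  define \<rho> :: "real ^ 'n \<Rightarrow> real ^ 'n well_ordered_copy" where "\<rho> x = (\<chi> i. x $ ?Rep i)" for x
  let ?X = "\<rho> ` v ` {0..CARD('n)}"
  have lin: "linear \<rho>" by (auto simp: \<rho>_def linear_iff vec_eq_iff)
  have card: "CARD('n well_ordered_copy) = CARD('n)"
    using bij_betw_same_card[OF bij_Rep_well_ordered_copy] .
  have inj: "inj \<rho>"
  proof (rule injI)
    fix x y assume "\<rho> x = \<rho> y"
    then have "x $ ?Rep i = y $ ?Rep i" for i by (simp add: \<rho>_def vec_eq_iff)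
    then show "x = y"
      by (metis bij_Rep_well_ordered_copy bij_pointE vec_eq_iff)
  qed
  have inj': "inj_on (\<rho> \<circ> v) {0..CARD('n)}"
    using v inj by (simp add: comp_inj_on inj_on_subset)
  have bij: "bij_betw (\<rho> \<circ> v \<circ> (h \<circ> ?Rep)) UNIV (?X - {\<rho> (v 0)})"
  proof (rule bij_betw_trans)
    show "bij_betw (h \<circ> ?Rep) UNIV {1..CARD('n)}"
      using bij_betw_trans[OF bij_Rep_well_ordered_copy h] .
    have "?X - {\<rho> (v 0)} = (\<rho> \<circ> v) ` ({0..CARD('n)} - {0})"
      using inj' by (subst inj_on_image_set_diff[OF inj']) (auto simp: image_comp)
    also have "{0..CARD('n)} - {0} = {1..CARD('n)}" by auto
    finally show "bij_betw (\<rho> \<circ> v) {1..CARD('n)} (?X - {\<rho> (v 0)})"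
      using inj' by (auto simp: bij_betw_def inj_on_def)
  qed
  have "measure lborel (convex hull (v ` {0..CARD('n)})) = measure lborel (\<rho> ` (convex hull (v ` {0..CARD('n)})))"
    unfolding \<rho>_def by (rule measure_lborel_reindex[symmetric])
      (auto intro!: bij_Rep_well_ordered_copy borel_closed compact_imp_closed finite_imp_compact_convex_hull)
  also have "\<rho> ` (convex hull (v ` {0..CARD('n)})) = convex hull ?X"
    using convex_hull_linear_image[OF lin] by metis
  also have "measure lborel (convex hull ?X) =
      \<bar>det (\<chi> i j. (\<rho> \<circ> v \<circ> (h \<circ> ?Rep)) j $ i - \<rho> (v 0) $ i)\<bar> / fact CARD('n well_ordered_copy)"
    using card_image[OF inj'] by (intro content_simplex[OF _ _ _ bij]) (auto simp: image_comp card)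
  also have "det (\<chi> i j. (\<rho> \<circ> v \<circ> (h \<circ> ?Rep)) j $ i - \<rho> (v 0) $ i) =
      det (\<chi> i j. (\<chi> k j. v (h j) $ k - v 0 $ k) $ ?Rep i $ ?Rep j)"
    by (simp add: \<rho>_def)
  finally show ?thesis
    by (simp only: det_reindex[OF bij_Rep_well_ordered_copy] card)
qed

section \<open>A criterion for Gorenstein simplices\<close>

text \<open>
  This is one half of a duality: the simplex \<open>{z. (\<forall>k. z $ k \<ge> -1) \<and> sum (($) z) UNIV \<le> 1}\<close> has the vertices
  \<open>-1\<close> and \<open>(d + 1) axis k 1 - 1\<close>, where \<open>1\<close> is the all-ones vector, and the assumptions say that \<open>y\<close> pairs
  with each of them to at most 1. Its dual is the convex hull of the normals of its facets, because
  the slacks of the assumptions, divided by \<open>d + 1\<close>, are the barycentric weights of \<open>y\<close>.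
\<close>

lemma mem_convex_hull_dual_simplex:
  fixes y :: "real ^ 'n"
  assumes 0: "- (\<Sum>i\<in>UNIV. y $ i) \<le> 1"
    and k: "\<And>k. real (CARD('n) + 1) * y $ k - (\<Sum>i\<in>UNIV. y $ i) \<le> 1"
  shows "y \<in> convex hull (insert 1 (range (\<lambda>k. - axis k 1)))"
proof -
  define m where "m = (1 + (\<Sum>i\<in>UNIV. y $ i)) / real (CARD('n) + 1)"
  have m: "m * real (CARD('n) + 1) = 1 + (\<Sum>i\<in>UNIV. y $ i)"
    unfolding m_def by simp
  define \<mu> where "\<mu> e = (case e of None \<Rightarrow> m | Some k \<Rightarrow> m - y $ k)" for e
  define q :: "'n option \<Rightarrow> real ^ 'n" where "q e = (case e of None \<Rightarrow> 1 | Some k \<Rightarrow> - axis k 1)" for e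
  have sum_option: "(\<Sum>e\<in>UNIV. F e) = F None + (\<Sum>k\<in>UNIV. F (Some k))"
    for F :: "'n option \<Rightarrow> 'b::ab_group_add"
    by (simp add: UNIV_option_conv sum.reindex)
  have "m \<ge> 0" using 0 by (simp add: m_def)
  moreover have "y $ k \<le> m" for k
    using k[of k] by (simp add: m_def field_simps)
  ultimately have "\<mu> e \<ge> 0" for e
    by (auto simp: \<mu>_def split: option.split)
  moreover have "sum \<mu> UNIV = 1"
    using m by (simp add: sum_option \<mu>_def sum_subtractf field_simps)
  moreover have "q e \<in> convex hull (insert 1 (range (\<lambda>k. - axis k 1)))" for e
    by (rule hull_inc) (auto simp: q_def split: option.split)
  ultimately have "(\<Sum>e\<in>UNIV. \<mu> e *\<^sub>R q e) \<in> convex hull (insert 1 (range (\<lambda>k. - axis k 1)))"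
    by (intro convex_sum) auto
  also have "(\<Sum>e\<in>UNIV. \<mu> e *\<^sub>R q e) = y"
    by (simp add: sum_option vec_eq_iff \<mu>_def q_def axis_def if_distrib[of "\<lambda>t. _ * t"] sum_negf cong: if_cong)
  finally show ?thesis .
qed

text \<open>
  The point \<open>c = (1/p, \<dots>, 1/p)\<close> has weight \<open>1/p\<close> at each of the \<open>d + 1\<close> vertices of the standard simplex
  dilated by \<open>r\<close>, since \<open>d + 1 = r p\<close>. Moving its image to the origin turns the dilated simplex into
  \<open>Q = W (T / p)\<close> with \<open>T = {z. (\<forall>k. z $ k \<ge> -1) \<and> sum (($) z) UNIV \<le> 1}\<close>. By the assumption on \<open>p\<close>-multiples,
  lattice points of \<open>Q\<close> come from integral \<open>z\<close>, and the inverse of \<open>W / p\<close> is an integer matrix, so that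
  its transpose maps the integral vertices of the dual of \<open>T\<close> to integral vertices of the dual of \<open>Q\<close>.
\<close>

theorem gorenstein_of_index_affine_image:
  fixes v0 :: "real ^ 'n" and W :: "real ^ 'n ^ 'n" and p :: nat and r :: int
  assumes "p > 0" "r > 0" and dim: "int CARD('n) + 1 = r * int p"
    and v0: "v0 \<in> int_lattice" and W_int: "integer_matrix W" and "invertible W"
    and p_mult: "\<And>x. W *v x \<in> int_lattice \<Longrightarrow> real p *\<^sub>R x \<in> int_lattice"
    and center: "W *v (\<chi> j. 1 / p) \<in> int_lattice"
  shows "gorenstein_of_index r ((\<lambda>x. v0 + W *v x) ` (convex hull (insert 0 Basis)))"
proof -
  let ?S = "convex hull (insert 0 Basis) :: (real ^ 'n) set"
  let ?\<Delta> = "(\<lambda>x. v0 + W *v x) ` ?S"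
  define c :: "real ^ 'n" where "c = (\<chi> j. 1 / p)"
  define w where "w = - (of_int r *\<^sub>R v0 + W *v c)"
  define f where "f x = W *v (of_int r *\<^sub>R x - c)" for x
  define Q where "Q = (\<lambda>x. of_int r *\<^sub>R x + w) ` ?\<Delta>"
  have dim': "real p * of_int r = real CARD('n) + 1"
    using arg_cong[OF dim, of real_of_int] by (simp add: mult.commute)
  obtain V where V: "W ** V = mat 1" "V ** W = mat 1"
    using \<open>invertible W\<close> unfolding invertible_def by blast
  have WV: "W *v (V *v x) = x" "V *v (W *v x) = x" for x
    using V by (simp_all add: matrix_vector_mul_assoc)
  have inj: "inj ((*v) W)"
    by (rule injI) (metis WV(2))
  have w_mem: "w \<in> int_lattice"
    unfolding w_def using v0 center
    by (intro int_lattice_minus int_lattice_add int_lattice_scaleR) (auto simp: c_def)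
  have Q_f: "Q = f ` ?S"
    unfolding Q_def f_def w_def image_image
    by (simp add: algebra_simps scaleR_right_distrib)
  have f_affine: "f = (\<lambda>x. - (W *v c) + W *v (of_int r *\<^sub>R x))"
    by (simp add: f_def fun_eq_iff matrix_vector_mult_diff_distrib)
  have lin_f: "linear (\<lambda>x. W *v (of_int r *\<^sub>R x))"
    by (simp add: linear_iff algebra_simps scaleR_right_distrib)
  have inj_f: "inj (\<lambda>x. W *v (of_int r *\<^sub>R x))"
    using \<open>r > 0\<close> by (intro injI) (auto dest!: injD[OF inj])
  have S_int: "interior ?S \<noteq> {}"
    using interior_std_simplex_nonempty by blast
  have vertices: "(\<lambda>x. v0 + W *v x) ` insert 0 Basis \<subseteq> int_lattice"
    using v0 W_int by (auto simp: Basis_vec_def integer_matrix_columns int_lattice_add)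
  have \<Delta>_hull: "?\<Delta> = convex hull ((\<lambda>x. v0 + W *v x) ` insert 0 Basis)"
    by (intro convex_hull_affine_image) simp
  have \<Delta>_full: "full_dim_lattice_polytope ?\<Delta>"
  proof (rule full_dim_if_interior)
    show "lattice_polytope ?\<Delta>"
      unfolding \<Delta>_hull using vertices by (intro lattice_polytope_convex_hull) auto
    show "interior ?\<Delta> \<noteq> {}"
      using S_int by (subst interior_affine_image) (simp_all add: inj)
  qed
  have Q_full: "full_dim_lattice_polytope Q"
  proof (rule full_dim_if_interior)
    have "Q = (\<lambda>x. w + of_int r *\<^sub>R x) ` (convex hull ((\<lambda>x. v0 + W *v x) ` insert 0 Basis))"
      unfolding Q_def \<Delta>_hull by (simp add: add.commute)
    also have "\<dots> = convex hull ((\<lambda>x. w + of_int r *\<^sub>R x) ` (\<lambda>x. v0 + W *v x) ` insert 0 Basis)"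
      by (intro convex_hull_affine_image) simp
    finally show "lattice_polytope Q"
      using vertices w_mem
      by (auto simp del: image_insert
          intro!: lattice_polytope_convex_hull int_lattice_add[of w] int_lattice_scaleR)
    show "interior Q \<noteq> {}"
      using S_int unfolding Q_f f_affine by (subst interior_affine_image) (simp_all add: inj_f lin_f)
  qed
  have Q_interior: "interior Q \<inter> int_lattice = {0}"
  proof -
    have int_Q: "interior Q = f ` interior ?S"
      unfolding Q_f f_affine using lin_f inj_f by (rule interior_affine_image)
    have "f x = 0" if x: "x \<in> interior ?S" and fx: "f x \<in> int_lattice" for x
    proof -
      define z where "z = real p *\<^sub>R (of_int r *\<^sub>R x - c)"
      have z_mem: "z \<in> int_lattice"
        unfolding z_def using fx by (intro p_mult) (simp add: f_def)
      have z_app: "z $ j = (real CARD('n) + 1) * x $ j - 1" for j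
        using \<open>p > 0\<close> by (simp add: z_def c_def right_diff_distrib dim'[symmetric])
      have z_nonneg: "z $ j \<ge> 0" for j
      proof -
        have "z $ j > -1" using x by (simp add: z_app mem_std_simplex_cart)
        moreover obtain m where "z $ j = of_int m"
          using z_mem by (auto simp: int_lattice_def elim: Ints_cases)
        ultimately show ?thesis by simp
      qed
      have "(\<Sum>j\<in>UNIV. z $ j) = (real CARD('n) + 1) * (\<Sum>j\<in>UNIV. x $ j) - real CARD('n)"
        by (simp add: z_app sum_subtractf sum_distrib_left)
      also have "\<dots> < (real CARD('n) + 1) * 1 - real CARD('n)"
        using x by (intro diff_strict_right_mono mult_strict_left_mono) (auto simp: mem_std_simplex_cart)
      finally have "(\<Sum>j\<in>UNIV. z $ j) < 1" by simp
      \<comment> \<open>Integers \<open>z $ j > -1\<close> with sum less than 1 can only be 0.\<close>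
      moreover have "(\<Sum>j\<in>UNIV. z $ j) \<in> \<int>"
        using z_mem by (auto simp: int_lattice_def)
      ultimately have "(\<Sum>j\<in>UNIV. z $ j) \<le> 0"
        by (auto elim!: Ints_cases)
      then have "\<forall>j\<in>UNIV. z $ j = 0"
        using z_nonneg by (metis (mono_tags) sum_nonneg sum_nonneg_eq_0_iff finite antisym)
      then have "z = 0" by (simp add: vec_eq_iff)
      then show ?thesis
        using \<open>p > 0\<close> by (simp add: z_def f_def)
    qed
    moreover have "0 \<in> f ` interior ?S"
    proof (rule image_eqI)
      \<comment> \<open>The barycentre of the standard simplex.\<close>
      define x0 where "x0 = (1 / of_int r) *\<^sub>R c"
      show "0 = f x0"
        using \<open>r > 0\<close> by (simp add: f_def x0_def)
      have "x0 $ j = 1 / (real CARD('n) + 1)" for j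
        unfolding dim'[symmetric] by (simp add: x0_def c_def)
      then show "x0 \<in> interior ?S"
        by (simp add: mem_std_simplex_cart)
    qed
    ultimately show ?thesis
      unfolding int_Q by (auto simp: int_lattice_0)
  qed
  have Q_dual: "lattice_polytope (dual_polytope Q)"
  proof -
    define L where "L z = real p *\<^sub>R (transpose V *v z)" for z
    define G :: "(real ^ 'n) set" where "G = insert 1 (range (\<lambda>k. - axis k 1))"
    have L_linear: "linear L"
      by (simp add: L_def linear_iff algebra_simps scaleR_right_distrib)
    \<comment> \<open>In the coordinates \<open>z\<close> given by \<open>L\<close> on the dual side, the pairing with \<open>Q\<close> no longer involves \<open>W\<close> and \<open>p\<close>.\<close>
    have pair: "f x \<bullet> L z = (real CARD('n) + 1) * (x \<bullet> z) - (\<Sum>j\<in>UNIV. z $ j)" for x z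
    proof -
      have "f x \<bullet> L z = real p * ((V *v f x) \<bullet> z)"
        by (simp add: L_def dot_lmul_matrix[symmetric] inner_commute)
      also have "V *v f x = of_int r *\<^sub>R x - c"
        by (simp add: f_def WV)
      also have "c \<bullet> z = (\<Sum>j\<in>UNIV. z $ j) / p"
        by (simp add: c_def inner_vec_def sum_divide_distrib)
      then have "real p * ((of_int r *\<^sub>R x - c) \<bullet> z) = (real p * of_int r) * (x \<bullet> z) - (\<Sum>j\<in>UNIV. z $ j)"
        using \<open>p > 0\<close> by (simp add: inner_diff_left right_diff_distrib)
      finally show ?thesis by (simp add: dim')
    qed
    have "dual_polytope Q = convex hull (L ` G)"
    proof
      show "dual_polytope Q \<subseteq> convex hull (L ` G)"
      proof
        fix y assume y: "y \<in> dual_polytope Q"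
        define z where "z = (1 / real p) *\<^sub>R (transpose W *v y)"
        have "transpose V *v (transpose W *v y) = y"
          by (metis V(1) matrix_transpose_mul matrix_vector_mul_assoc matrix_vector_mul_lid transpose_mat)
        then have Lz: "L z = y"
          using \<open>p > 0\<close> by (simp add: L_def z_def matrix_vector_mult_scaleR)
        have le: "(real CARD('n) + 1) * (x \<bullet> z) - (\<Sum>j\<in>UNIV. z $ j) \<le> 1" if "x \<in> ?S" for x
          using y that unfolding dual_polytope_def Q_f pair[symmetric] Lz by auto
        have "z \<in> convex hull G"
          unfolding G_def
        proof (rule mem_convex_hull_dual_simplex)
          \<comment> \<open>Test the defining inequality of the dual at the vertices of the standard simplex.\<close>
          show "- (\<Sum>i\<in>UNIV. z $ i) \<le> 1"
            using le[of 0] by (simp add: hull_inc)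
          show "real (CARD('n) + 1) * z $ k - (\<Sum>i\<in>UNIV. z $ i) \<le> 1" for k
            using le[of "axis k 1"] by (simp add: hull_inc inner_axis' axis_in_Basis_iff add.commute)
        qed
        then show "y \<in> convex hull (L ` G)"
          unfolding Lz[symmetric] convex_hull_linear_image[OF L_linear, symmetric] by blast
      qed
      have "dual_polytope Q = (\<Inter>x\<in>Q. {y. x \<bullet> y \<le> 1})"
        by (auto simp: dual_polytope_def)
      then have "convex (dual_polytope Q)"
        by (simp add: convex_INT convex_halfspace_le)
      moreover have "L ` G \<subseteq> dual_polytope Q"
      proof -
        have "f x \<bullet> L z \<le> 1" if x: "x \<in> ?S" and z: "z \<in> G" for x z
        proof (cases "z = 1")
          case True
          have "(real CARD('n) + 1) * (\<Sum>j\<in>UNIV. x $ j) - real CARD('n) \<le>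
              (real CARD('n) + 1) * 1 - real CARD('n)"
            using x by (intro diff_right_mono mult_left_mono) (auto simp: mem_std_simplex_cart)
          also have "\<dots> = 1" by simp
          finally show ?thesis
            unfolding pair True by (simp add: inner_vec_def)
        next
          case False
          then obtain k where z: "z = - axis k 1" using z by (auto simp: G_def)
          have "x $ k \<ge> 0" using x by (simp add: mem_std_simplex_cart)
          then show ?thesis
            unfolding pair z by (simp add: inner_axis sum_negf) (simp add: axis_def)
        qed
        then show ?thesis
          by (auto simp: dual_polytope_def Q_f)
      qed
      ultimately show "convex hull (L ` G) \<subseteq> dual_polytope Q"
        by (simp add: hull_minimal)
    qed
    moreover have "L ` G \<subseteq> int_lattice"
    proof -
      have "integer_matrix (real p *\<^sub>R V)"
        unfolding integer_matrix_iff
        by (auto simp: scaleR_matrix_vector_assoc[symmetric] WV intro!: p_mult)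
      then have "integer_matrix (transpose (real p *\<^sub>R V))"
        by (rule integer_matrix_transpose)
      moreover have "L z = transpose (real p *\<^sub>R V) *v z" for z
        by (simp add: L_def vec_eq_iff matrix_vector_mult_def transpose_def sum_distrib_left mult.assoc)
      moreover have "G \<subseteq> int_lattice"
        by (auto simp: G_def int_lattice_minus int_lattice_axis) (simp add: int_lattice_def)
      ultimately show ?thesis
        by (auto simp: integer_matrix_iff)
    qed
    ultimately show ?thesis
      by (simp add: lattice_polytope_convex_hull G_def)
  qed
  show ?thesis
    unfolding gorenstein_of_index_def reflexive_polytope_def
    using \<open>r > 0\<close> \<Delta>_full Q_full Q_interior Q_dual w_mem Q_def by blast
qed

section \<open>Edge coordinates of a simplex\<close>

text \<open>
  The vertices \<open>v 1, \<dots>, v d\<close> are numbered, while the columns of a matrix are indexed by a type; the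
  bijection \<open>h\<close> translates between both.
\<close>

definition edge_matrix :: "(nat \<Rightarrow> real ^ 'n) \<Rightarrow> ('n \<Rightarrow> nat) \<Rightarrow> real ^ 'n ^ 'n" where
  "edge_matrix v h = (\<chi> k j. (v (h j) - v 0) $ k)"

lemma edge_matrix_axis: "edge_matrix v h *v axis j 1 = v (h j) - v 0"
  by (simp add: edge_matrix_def matrix_vector_mult_basis column_def vec_eq_iff)

lemma edge_matrix_mult:
  fixes v :: "nat \<Rightarrow> real ^ 'n" and h :: "'n \<Rightarrow> nat"
  assumes h: "bij_betw h UNIV {1..CARD('n)}"
  shows "edge_matrix v h *v (\<chi> j. x (h j)) =
    (\<Sum>i=0..CARD('n). x i *\<^sub>R v i) - (\<Sum>i=0..CARD('n). x i) *\<^sub>R v 0"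
proof -
  have "edge_matrix v h *v (\<chi> j. x (h j)) = (\<Sum>j\<in>UNIV. x (h j) *\<^sub>R (v (h j) - v 0))"
    by (simp add: edge_matrix_def matrix_vector_mult_def vec_eq_iff mult.commute)
  also have "\<dots> = (\<Sum>i=1..CARD('n). x i *\<^sub>R (v i - v 0))"
    by (rule sum.reindex_bij_betw[OF h])
  also have "\<dots> = (\<Sum>i=0..CARD('n). x i *\<^sub>R (v i - v 0))"
    by (subst (2) sum.atLeast_Suc_atMost) auto
  finally show ?thesis
    by (simp add: scaleR_right_diff_distrib sum_subtractf scaleR_left.sum)
qed

lemma integer_matrix_edge_matrix:
  fixes v :: "nat \<Rightarrow> real ^ 'n"
  assumes h: "bij_betw h UNIV {1..CARD('n)}"
    and v: "\<And>i. i \<le> CARD('n) \<Longrightarrow> v i \<in> int_lattice"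
  shows "integer_matrix (edge_matrix v h)"
  unfolding integer_matrix_columns edge_matrix_axis
  using v h by (auto intro!: int_lattice_diff dest: bij_betwE)

text \<open>
  Edge coordinates \<open>x\<close> become affine weights on all vertices once the vertex 0 gets the weight that makes
  the sum vanish.
\<close>

lemma edge_matrix_weights:
  fixes x :: "real ^ 'n" and h :: "'n \<Rightarrow> nat"
  assumes h: "bij_betw h UNIV {1..CARD('n)}"
  obtains y where "\<And>j. y (h j) = x $ j" and "(\<Sum>i=0..CARD('n). y i) = 0"
    and "\<And>v :: nat \<Rightarrow> real ^ 'n. (\<Sum>i=0..CARD('n). y i *\<^sub>R v i) = edge_matrix v h *v x"
proof -
  define y where "y i = (if i = 0 then - (\<Sum>j\<in>UNIV. x $ j) else x $ inv_into UNIV h i)" for i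
  have y_h: "y (h j) = x $ j" for j
  proof -
    have "h j \<in> {1..CARD('n)}" using bij_betwE[OF h] by blast
    then show ?thesis using h by (simp add: y_def bij_betw_def)
  qed
  have "(\<Sum>i=1..CARD('n). y i) = (\<Sum>j\<in>UNIV. x $ j)"
    by (subst sum.reindex_bij_betw[OF h, symmetric]) (simp add: y_h)
  then have sum_y: "(\<Sum>i=0..CARD('n). y i) = 0"
    by (subst sum.atLeast_Suc_atMost) (auto simp: y_def)
  have "(\<Sum>i=0..CARD('n). y i *\<^sub>R v i) = edge_matrix v h *v x" for v :: "nat \<Rightarrow> real ^ 'n"
    using edge_matrix_mult[OF h, of v y] by (simp add: sum_y y_h)
  with y_h sum_y show thesis by (rule that)
qed

lemma invertible_edge_matrix:
  fixes v :: "nat \<Rightarrow> real ^ 'n"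
  assumes h: "bij_betw h UNIV {1..CARD('n)}"
    and v: "inj_on v {0..CARD('n)}" and indep: "\<not> affine_dependent (v ` {0..CARD('n)})"
  shows "invertible (edge_matrix v h)"
  unfolding invertible_left_inverse matrix_left_invertible_ker
proof (intro allI impI)
  fix x assume x: "edge_matrix v h *v x = 0"
  obtain y where y_h: "\<And>j. y (h j) = x $ j" and sum_y: "(\<Sum>i=0..CARD('n). y i) = 0"
    and comb_y: "(\<Sum>i=0..CARD('n). y i *\<^sub>R v i) = 0"
    using edge_matrix_weights[OF h, of x] x by metis
  have h_range: "h j \<in> {1..CARD('n)}" for j
    using bij_betwE[OF h] by blast
  \<comment> \<open>A kernel vector yields an affine dependence of the vertices.\<close>
  define u where "u z = y (inv_into {0..CARD('n)} v z)" for z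
  have u_v: "u (v i) = y i" if "i \<in> {0..CARD('n)}" for i
    using v that by (simp add: u_def)
  have "sum u (v ` {0..CARD('n)}) = 0" "(\<Sum>z\<in>v ` {0..CARD('n)}. u z *\<^sub>R z) = 0"
    using sum_y comb_y u_v by (simp_all add: sum.reindex[OF v])
  then have "\<forall>z\<in>v ` {0..CARD('n)}. u z = 0"
    using indep affine_dependent_explicit_finite[of "v ` {0..CARD('n)}"] by auto
  then have "y (h j) = 0" for j
    using u_v[of "h j"] h_range[of j] by auto
  then show "x = 0"
    by (simp add: y_h vec_eq_iff)
qed

lemma convex_hull_vertices:
  fixes v :: "nat \<Rightarrow> real ^ 'n"
  assumes h: "bij_betw h UNIV {1..CARD('n)}"
  shows "convex hull (v ` {0..CARD('n)}) =
    (\<lambda>x. v 0 + edge_matrix v h *v x) ` (convex hull (insert 0 Basis))"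
proof -
  have Basis: "(Basis :: (real ^ 'n) set) = range (\<lambda>j. axis j 1)"
    by (auto simp: Basis_vec_def)
  have "{0..CARD('n)} = insert 0 {1..CARD('n)}"
    by auto
  also have "{1..CARD('n)} = range h"
    using h by (simp add: bij_betw_def)
  finally have "v ` {0..CARD('n)} = (\<lambda>x. v 0 + edge_matrix v h *v x) ` insert 0 Basis"
    unfolding Basis by (simp add: image_image edge_matrix_axis)
  then show ?thesis
    by (simp only: convex_hull_affine_image[OF matrix_vector_mul_linear])
qed

text \<open>
  The extreme points of the hull of an affinely independent set are the points of that set.
\<close>

lemma lattice_simplex_vertices:
  fixes \<Delta> :: "(real ^ 'n) set"
  assumes "full_dim_lattice_simplex \<Delta>" "ordered_vertices v \<Delta>"
  shows "\<Delta> = convex hull (v ` {0..CARD('n)})"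
    and "inj_on v {0..CARD('n)}" and "\<not> affine_dependent (v ` {0..CARD('n)})"
    and "\<And>i. i \<le> CARD('n) \<Longrightarrow> v i \<in> int_lattice"
proof -
  obtain C where C: "\<not> affine_dependent C" "\<Delta> = convex hull C"
    and ext: "{x. x extreme_point_of \<Delta>} \<subseteq> int_lattice"
    using assms(1) by (auto simp: full_dim_lattice_simplex_def lattice_polytope_def simplex_def)
  have "{x. x extreme_point_of \<Delta>} = C"
    using C by (simp add: extreme_point_of_convex_hull_affine_independent)
  moreover have bij: "bij_betw v {0..CARD('n)} {x. x extreme_point_of \<Delta>}"
    using assms(2) by (simp add: ordered_vertices_def)
  ultimately have "v ` {0..CARD('n)} = C"
    by (simp add: bij_betw_def)
  then show "\<Delta> = convex hull (v ` {0..CARD('n)})" "\<not> affine_dependent (v ` {0..CARD('n)})"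
    using C by simp_all
  show "inj_on v {0..CARD('n)}"
    using bij by (rule bij_betw_imp_inj_on)
  show "v i \<in> int_lattice" if "i \<le> CARD('n)" for i
    using bij_betwE[OF bij] ext that by auto
qed

section \<open>The group of a simplex in edge coordinates\<close>

lemma real_mod_int_add: "real_mod_int x + real_mod_int y = real_mod_int (x + y)"
  and real_mod_int_minus: "- real_mod_int x = real_mod_int (- x)"
  and real_mod_int_eq_iff: "real_mod_int x = real_mod_int y \<longleftrightarrow> x - y \<in> \<int>"
  by (simp_all add: plus_real_mod_int.abs_eq uminus_real_mod_int.abs_eq real_mod_int.abs_eq_iff)

lemma real_mod_int_0: "real_mod_int 0 = 0"
  by (simp add: zero_real_mod_int_def)

text \<open>
  The representative of the entry at 0 may be changed by an integer so that all representatives sum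
  to an integer; then the combination of the vertices and the one of the edges differ by a multiple
  of \<open>v 0\<close>.
\<close>

lemma Lambda_group_carrierD:
  fixes v :: "nat \<Rightarrow> real ^ 'n"
  assumes h: "bij_betw h UNIV {1..CARD('n)}"
    and v: "\<And>i. i \<le> CARD('n) \<Longrightarrow> v i \<in> int_lattice"
    and f: "f \<in> carrier (Lambda_group v)"
    and x: "\<And>i. i \<in> {1..CARD('n)} \<Longrightarrow> f i = real_mod_int (x i)"
  shows "edge_matrix v h *v (\<chi> j. x (h j)) \<in> int_lattice"
proof -
  obtain y where y: "\<And>i. i \<le> CARD('n) \<Longrightarrow> f i = real_mod_int (y i)"
    and y_mem: "(\<Sum>i=0..CARD('n). y i *\<^sub>R (v i, 1 :: real)) \<in> int_lattice \<times> \<int>"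
    using f by (auto simp: Lambda_group_def)
  \<comment> \<open>Prescribed representatives at positive indices, and any valid one at 0.\<close>
  define x' where "x' = x(0 := y 0)"
  have "(\<Sum>i=0..CARD('n). x' i *\<^sub>R (v i, 1 :: real)) \<in> int_lattice \<times> \<int>"
    using v _ y_mem by (rule Lambda_group_representatives) (use x y in \<open>auto simp: x'_def Suc_le_eq\<close>)
  then have "(\<Sum>i=0..CARD('n). x' i *\<^sub>R v i) \<in> int_lattice" "(\<Sum>i=0..CARD('n). x' i) \<in> \<int>"
    by (simp_all add: sum_prod)
  then have "edge_matrix v h *v (\<chi> j. x' (h j)) \<in> int_lattice"
    unfolding edge_matrix_mult[OF h] using v[of 0] by (intro int_lattice_diff int_lattice_scaleR) auto
  moreover have "h j \<noteq> 0" for j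
    using h by (metis UNIV_I atLeastAtMost_iff bij_betwE not_one_le_zero)
  ultimately show ?thesis
    by (simp add: x'_def)
qed

lemma Lambda_group_carrierI:
  fixes v :: "nat \<Rightarrow> real ^ 'n"
  assumes h: "bij_betw h UNIV {1..CARD('n)}"
    and x: "edge_matrix v h *v x \<in> int_lattice"
  obtains f where "f \<in> carrier (Lambda_group v)" "\<And>j. f (h j) = real_mod_int (x $ j)"
proof -
  obtain y where y_h: "\<And>j. y (h j) = x $ j" and sum_y: "(\<Sum>i=0..CARD('n). y i) = 0"
    and comb_y: "\<And>v :: nat \<Rightarrow> real ^ 'n. (\<Sum>i=0..CARD('n). y i *\<^sub>R v i) = edge_matrix v h *v x"
    using edge_matrix_weights[OF h, of x] by metis
  define f where "f = (\<lambda>i\<in>{0..CARD('n)}. real_mod_int (y i))"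
  have h_range: "h j \<in> {1..CARD('n)}" for j
    using bij_betwE[OF h] by blast
  have "f \<in> carrier (Lambda_group v)"
    using x sum_y comb_y by (auto simp: Lambda_group_def f_def sum_prod intro!: exI[of _ y])
  moreover have "f (h j) = real_mod_int (x $ j)" for j
    using h_range[of j] by (simp add: f_def y_h)
  ultimately show thesis using that by blast
qed

lemma mult_Lambda_group: "f \<otimes>\<^bsub>Lambda_group v\<^esub> g = (\<lambda>i\<in>{0..CARD('n)}. f i + g i)"
  and one_Lambda_group: "\<one>\<^bsub>Lambda_group v\<^esub> = (\<lambda>i\<in>{0..CARD('n)}. 0)"
  for v :: "nat \<Rightarrow> real ^ 'n"
  by (simp_all add: Lambda_group_def real_mod_int_group_def product_group_def)

text \<open>
  Inverses are needed explicitly since \<open>generate\<close> closes under them.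
\<close>

lemma inv_Lambda_group:
  fixes v :: "nat \<Rightarrow> real ^ 'n"
  assumes f: "f \<in> carrier (Lambda_group v)"
  shows "inv\<^bsub>Lambda_group v\<^esub> f = (\<lambda>i\<in>{0..CARD('n)}. - f i)"
proof -
  obtain x where f_ext: "f \<in> extensional {0..CARD('n)}"
    and x: "\<And>i. i \<in> {0..CARD('n)} \<Longrightarrow> f i = real_mod_int (x i)"
    and x_mem: "(\<Sum>i=0..CARD('n). x i *\<^sub>R (v i, 1 :: real)) \<in> int_lattice \<times> \<int>"
    using f by (auto simp: Lambda_group_def PiE_def)
  have "(\<Sum>i=0..CARD('n). (- x i) *\<^sub>R (v i, 1 :: real)) \<in> int_lattice \<times> \<int>"
    using x_mem by (auto simp: sum_prod sum_negf int_lattice_minus)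
  then have mem: "(\<lambda>i\<in>{0..CARD('n)}. - f i) \<in> carrier (Lambda_group v)"
    using x by (auto simp: Lambda_group_def real_mod_int_minus intro!: exI[of _ "\<lambda>i. - x i"])
  show ?thesis
    unfolding m_inv_def
  proof (rule the_equality)
    show "(\<lambda>i\<in>{0..CARD('n)}. - f i) \<in> carrier (Lambda_group v) \<and>
      f \<otimes>\<^bsub>Lambda_group v\<^esub> (\<lambda>i\<in>{0..CARD('n)}. - f i) = \<one>\<^bsub>Lambda_group v\<^esub> \<and>
      (\<lambda>i\<in>{0..CARD('n)}. - f i) \<otimes>\<^bsub>Lambda_group v\<^esub> f = \<one>\<^bsub>Lambda_group v\<^esub>"
      using mem by (auto simp: mult_Lambda_group one_Lambda_group fun_eq_iff restrict_def)
  next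
    fix g assume g: "g \<in> carrier (Lambda_group v) \<and>
      f \<otimes>\<^bsub>Lambda_group v\<^esub> g = \<one>\<^bsub>Lambda_group v\<^esub> \<and> g \<otimes>\<^bsub>Lambda_group v\<^esub> f = \<one>\<^bsub>Lambda_group v\<^esub>"
    show "g = (\<lambda>i\<in>{0..CARD('n)}. - f i)"
    proof
      fix i
      show "g i = (\<lambda>i\<in>{0..CARD('n)}. - f i) i"
      proof (cases "i \<in> {0..CARD('n)}")
        case True
        have "(f \<otimes>\<^bsub>Lambda_group v\<^esub> g) i = (\<one>\<^bsub>Lambda_group v\<^esub> :: nat \<Rightarrow> _) i"
          using g by simp
        then show ?thesis
          using True by (simp add: mult_Lambda_group one_Lambda_group eq_neg_iff_add_eq_0 add.commute)
      next
        case False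
        then show ?thesis
          using g by (auto simp: Lambda_group_def PiE_def extensional_def)
      qed
    qed
  qed
qed

lemma generate_Lambda_group_combination:
  fixes v :: "nat \<Rightarrow> real ^ 'n" and q :: "'i \<Rightarrow> nat \<Rightarrow> real"
  assumes "finite I" and f: "f \<in> generate (Lambda_group v) (\<gamma> ` I)"
    and mem: "\<And>i. i \<in> I \<Longrightarrow> \<gamma> i \<in> carrier (Lambda_group v)"
    and q: "\<And>i j. i \<in> I \<Longrightarrow> j \<in> {1..CARD('n)} \<Longrightarrow> \<gamma> i j = real_mod_int (q i j)"
  shows "\<exists>c :: 'i \<Rightarrow> int. \<forall>j\<in>{1..CARD('n)}. f j = real_mod_int (\<Sum>i\<in>I. of_int (c i) * q i j)"
  using f
proof (induction rule: generate.induct)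
  case one
  show ?case
    by (rule exI[of _ "\<lambda>_. 0"]) (simp add: one_Lambda_group real_mod_int_0)
next
  case (incl f)
  then obtain i where "i \<in> I" "f = \<gamma> i" by blast
  then show ?case
    using \<open>finite I\<close> q
    by (intro exI[of _ "\<lambda>k. if k = i then 1 else 0"])
      (simp add: if_distrib[of of_int] if_distrib[of "\<lambda>t. t * _"] cong: if_cong)
next
  case (inv f)
  then obtain i where "i \<in> I" "f = \<gamma> i" by blast
  then show ?case
    using \<open>finite I\<close> q mem
    by (intro exI[of _ "\<lambda>k. if k = i then - 1 else 0"])
      (simp add: inv_Lambda_group real_mod_int_minus if_distrib[of of_int] if_distrib[of "\<lambda>t. t * _"] cong: if_cong)
next
  case (eng f g)
  then obtain c e :: "'i \<Rightarrow> int" where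
    "\<forall>j\<in>{1..CARD('n)}. f j = real_mod_int (\<Sum>i\<in>I. of_int (c i) * q i j)"
    "\<forall>j\<in>{1..CARD('n)}. g j = real_mod_int (\<Sum>i\<in>I. of_int (e i) * q i j)"
    by blast
  then show ?case
    by (intro exI[of _ "\<lambda>i. c i + e i"])
      (simp add: mult_Lambda_group real_mod_int_add distrib_right sum.distrib)
qed

text \<open>
  Dropping the entry at 0 identifies the group \<open>\<Lambda>\<close> of the simplex with the lattice
  \<open>{x. edge_matrix v h *v x \<in> int_lattice}\<close> modulo \<open>\<int>\<^sup>d\<close>. Generators of the group, lifted to real vectors,
  therefore generate the lattice together with \<open>\<int>\<^sup>d\<close>.
\<close>

theorem edge_lattice_eq_generated:
  fixes v :: "nat \<Rightarrow> real ^ 'n" and q :: "'i \<Rightarrow> nat \<Rightarrow> real"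
  assumes h: "bij_betw h UNIV {1..CARD('n)}"
    and v: "\<And>i. i \<le> CARD('n) \<Longrightarrow> v i \<in> int_lattice"
    and "finite I" and generates: "generate (Lambda_group v) (\<gamma> ` I) = carrier (Lambda_group v)"
    and q: "\<And>i j. i \<in> I \<Longrightarrow> j \<in> {1..CARD('n)} \<Longrightarrow> \<gamma> i j = real_mod_int (q i j)"
  shows "edge_matrix v h *v x \<in> int_lattice \<longleftrightarrow>
    (\<exists>c :: 'i \<Rightarrow> int. x - (\<Sum>i\<in>I. of_int (c i) *\<^sub>R (\<chi> j. q i (h j))) \<in> int_lattice)"
    (is "_ \<longleftrightarrow> (\<exists>c. x - ?comb c \<in> _)")
proof -
  have mem: "\<gamma> i \<in> carrier (Lambda_group v)" if "i \<in> I" for i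
    using that generates generate.incl[of "\<gamma> i" "\<gamma> ` I"] by blast
  show ?thesis
  proof
    assume "edge_matrix v h *v x \<in> int_lattice"
    then obtain f where f: "f \<in> carrier (Lambda_group v)" "\<And>j. f (h j) = real_mod_int (x $ j)"
      using Lambda_group_carrierI[OF h] by blast
    then obtain c :: "'i \<Rightarrow> int" where
      c: "\<forall>j\<in>{1..CARD('n)}. f j = real_mod_int (\<Sum>i\<in>I. of_int (c i) * q i j)"
      using generate_Lambda_group_combination[where \<gamma> = \<gamma> and q = q, OF \<open>finite I\<close> _ mem q, of f]
        generates by blast
    have "x $ j - (\<Sum>i\<in>I. of_int (c i) * q i (h j)) \<in> \<int>" for j
    proof -
      have "h j \<in> {1..CARD('n)}"
        using h by (auto dest: bij_betwE)
      then show ?thesis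
        using c f(2)[of j] by (simp flip: real_mod_int_eq_iff)
    qed
    then show "\<exists>c. x - ?comb c \<in> int_lattice"
      by (auto simp: int_lattice_def)
  next
    assume "\<exists>c. x - ?comb c \<in> int_lattice"
    then obtain c :: "'i \<Rightarrow> int" where c: "x - ?comb c \<in> int_lattice" ..
    have "integer_matrix (edge_matrix v h)"
      using h v by (rule integer_matrix_edge_matrix)
    then have "edge_matrix v h *v (x - ?comb c) \<in> int_lattice"
      using c by (simp add: integer_matrix_iff)
    moreover have "edge_matrix v h *v ?comb c \<in> int_lattice"
      using Lambda_group_carrierD[where v = v and x = "q _", OF h v mem q]
      by (auto simp: linear_sum[OF matrix_vector_mul_linear] matrix_vector_mult_scaleR
          intro!: int_lattice_sum int_lattice_scaleR)
    ultimately have "edge_matrix v h *v (x - ?comb c) + edge_matrix v h *v ?comb c \<in> int_lattice"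
      by (rule int_lattice_add)
    then show "edge_matrix v h *v x \<in> int_lattice"
      by (simp add: matrix_vector_mult_diff_distrib)
  qed
qed

section \<open>The generators and their sum\<close>

definition gen_lift :: "nat \<Rightarrow> (nat \<Rightarrow> nat) \<Rightarrow> (nat \<Rightarrow> nat \<Rightarrow> int) \<Rightarrow> nat \<Rightarrow> nat \<Rightarrow> real" where
  "gen_lift p s a i j =
     (if 1 \<le> j \<and> j \<le> s i - 1 \<and> j \<notin> s ` {1..<i} then (real p - of_int (a i j)) / real p
      else if j = s i then 1 / real p
      else 0)"

lemma gen_eq_gen_lift:
  "j \<in> {1..d} \<Longrightarrow> gen d p s a i j = real_mod_int (gen_lift p s a i j)"
  by (simp add: gen_def gen_entry_def gen_lift_def real_mod_int_0)

lemma mult_gen_lift_Ints: "p > 0 \<Longrightarrow> real p * gen_lift p s a i j \<in> \<int>"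
  by (simp add: gen_lift_def)

text \<open>
  Column \<open>s k\<close> has only one nonzero entry: a generator \<open>i < k\<close> ends before position \<open>s k\<close>, and for \<open>i > k\<close>
  the position \<open>s k\<close> is excluded by definition.
\<close>

lemma gen_lift_pivot:
  assumes s: "strict_mono_on {1..l} s" and "i \<in> {1..l}" "k \<in> {1..l}"
  shows "gen_lift p s a i (s k) = (if k = i then 1 / real p else 0)"
proof (cases i k rule: linorder_cases)
  case less
  then have "s i < s k" using assms by (auto intro: strict_mono_onD)
  then have "\<not> s k \<le> s i - 1" "s k \<noteq> s i" by linarith+
  then show ?thesis using less by (simp add: gen_lift_def)
next
  case equal
  then show ?thesis by (auto simp: gen_lift_def)
next
  case greater
  then have "s k < s i" "k \<in> {1..<i}" using assms by (auto intro: strict_mono_onD)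
  then show ?thesis using greater by (simp add: gen_lift_def)
qed

text \<open>
  All entries of the sum of the generators are \<open>1/p\<close> modulo \<open>\<int>\<close>. For \<open>j = s k\<close> only generator \<open>k\<close>
  contributes; in any other column the entries with \<open>s i > j\<close> are \<open>1 - a i j / p\<close>, where these \<open>a i j\<close> add up
  to \<open>-1\<close> modulo \<open>p\<close>, and the remaining entries vanish.
\<close>

lemma sum_gen_lift:
  assumes "p > 0" and s: "strict_mono_on {1..l} s" and "s l = d" and "0 < l"
    and col: "\<forall>j. 1 \<le> j \<and> j \<le> d - 1 \<and> j \<notin> s ` {1..l} \<longrightarrow>
           (\<exists>t::int. t > 0 \<and> (\<Sum>i\<in>{i\<in>{1..l}. s i > j}. a i j) = t * int p - 1)"
    and j: "j \<in> {1..d}"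
  shows "1 / real p - (\<Sum>i\<in>{1..l}. gen_lift p s a i j) \<in> \<int>"
proof (cases "j \<in> s ` {1..l}")
  case True
  then obtain k where "k \<in> {1..l}" "j = s k" by blast
  then show ?thesis
    by (simp add: gen_lift_pivot[OF s])
next
  case False
  let ?I = "{i\<in>{1..l}. s i > j}"
  have "d \<in> s ` {1..l}" using \<open>s l = d\<close> \<open>0 < l\<close> by auto
  then have "j \<noteq> d" using False by blast
  then have "j \<le> d - 1" using j by auto
  then obtain t :: int where t: "(\<Sum>i\<in>?I. a i j) = t * int p - 1"
    using col j False by auto
  have "gen_lift p s a i j = (if j < s i then 1 - of_int (a i j) / real p else 0)" if "i \<in> {1..l}" for i
  proof -
    have "j \<notin> s ` {1..<i}" "j \<noteq> s i" using False that by auto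
    then show ?thesis
      using j \<open>p > 0\<close> by (auto simp: gen_lift_def diff_divide_distrib)
  qed
  then have "(\<Sum>i\<in>{1..l}. gen_lift p s a i j) =
      (\<Sum>i\<in>{1..l}. if j < s i then 1 - of_int (a i j) / real p else 0)"
    by (intro sum.cong) auto
  also have "\<dots> = (\<Sum>i\<in>?I. 1 - of_int (a i j) / real p)"
    by (rule sum.inter_filter[symmetric]) simp
  also have "\<dots> = real (card ?I) - of_int (\<Sum>i\<in>?I. a i j) / real p"
    by (simp add: sum_subtractf sum_divide_distrib)
  also have "\<dots> = real (card ?I) - of_int t + 1 / real p"
    unfolding t using \<open>p > 0\<close> by (simp add: field_simps)
  finally show ?thesis by simp
qed

section \<open>Gorenstein index and normalized volume\<close>

theorem theorem3p5:
  fixes p d l :: nat and r :: int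
    and s :: "nat \<Rightarrow> nat" and a :: "nat \<Rightarrow> nat \<Rightarrow> int"
    and \<Delta> :: "(real ^ 'n) set" and v :: "nat \<Rightarrow> real ^ 'n"
  assumes "prime p"
    and "d = CARD('n)"
    and "0 < d" and "0 < l" and "l \<le> d"
    and "\<forall>i\<in>{1..l}. 1 \<le> s i" and "strict_mono_on {1..l} s" and "s l = d"
    and "\<forall>i\<in>{1..l}. \<forall>j. 1 \<le> j \<and> j \<le> s i - 1 \<and> j \<notin> s ` {1..<i} \<longrightarrow> 1 \<le> a i j \<and> a i j \<le> int p - 1"
    and "int d = r * int p - 1"
    and "\<forall>j. 1 \<le> j \<and> j \<le> d - 1 \<and> j \<notin> s ` {1..l} \<longrightarrow>
           (\<exists>t::int. t > 0 \<and> (\<Sum>i\<in>{i\<in>{1..l}. s i > j}. a i j) = t * int p - 1)"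
    and "full_dim_lattice_simplex \<Delta>"
    and "ordered_vertices v \<Delta>"
    and "generate (Lambda_group v) (gen d p s a ` {1..l}) = carrier (Lambda_group v)"
  shows "gorenstein_of_index r \<Delta> \<and> normalized_volume \<Delta> = real (p ^ l)"
proof -
  note d = assms(2) and s = assms(7)
  have p: "p > 0" using \<open>prime p\<close> prime_gt_0_nat by blast
  have "r * int p > 0" using assms(10) by linarith
  then have r: "r > 0" using p by (simp add: zero_less_mult_iff)
  obtain h' :: "nat \<Rightarrow> 'n" where "bij_betw h' {1..CARD('n)} UNIV"
    using ex_bij_betw_nat_finite_1[of "UNIV :: 'n set"] by auto
  then obtain h :: "'n \<Rightarrow> nat" where h: "bij_betw h UNIV {1..CARD('n)}"
    using bij_betw_inv_into by blast
  have h_range: "h j \<in> {1..d}" for j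
    using h d by (auto dest: bij_betwE)
  have s_range: "s ` {1..l} \<subseteq> {1..d}"
  proof
    fix j assume "j \<in> s ` {1..l}"
    then obtain i where i: "i \<in> {1..l}" "j = s i" by blast
    have "s i \<le> s l"
      using i \<open>0 < l\<close> by (intro strict_mono_on_leD[OF s]) auto
    then show "j \<in> {1..d}" using i assms(6) \<open>s l = d\<close> by auto
  qed
  have inj_s: "inj_on s {1..l}" using s strict_mono_on_imp_inj_on by blast
  note \<Delta> = lattice_simplex_vertices[OF assms(12,13)]
  define W where "W = edge_matrix v h"
  define G where "G i = (\<chi> j. gen_lift p s a i (h j))" for i
  have W_iff: "W *v x \<in> int_lattice \<longleftrightarrow>
      (\<exists>c :: nat \<Rightarrow> int. x - (\<Sum>i\<in>{1..l}. of_int (c i) *\<^sub>R G i) \<in> int_lattice)" for x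
    unfolding W_def G_def
    using gen_eq_gen_lift[of _ d p s a]
    by (intro edge_lattice_eq_generated[OF h \<Delta>(4) finite_atLeastAtMost assms(14)]) (simp_all add: d)
  have W_int: "integer_matrix W"
    unfolding W_def using h \<Delta>(4) by (rule integer_matrix_edge_matrix)
  have W_inv: "invertible W"
    unfolding W_def using h \<Delta>(2,3) by (rule invertible_edge_matrix)
  have pG: "real p *\<^sub>R G i \<in> int_lattice" for i
    using mult_gen_lift_Ints[OF p] by (simp add: int_lattice_def G_def)
  have WG: "W *v G k \<in> int_lattice" if "k \<in> {1..l}" for k
  proof -
    have "G k - (\<Sum>i\<in>{1..l}. of_int (if i = k then 1 else 0) *\<^sub>R G i) = 0"
      using that by (simp add: if_distrib[of of_int] if_distrib[of "\<lambda>t. t *\<^sub>R _"] cong: if_cong)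
    then show ?thesis
      unfolding W_iff by (intro exI[of _ "\<lambda>i. if i = k then 1 else 0"]) (simp only: int_lattice_0)
  qed
  have \<Delta>_image: "\<Delta> = (\<lambda>x. v 0 + W *v x) ` (convex hull (insert 0 Basis))"
    unfolding \<Delta>(1) W_def by (rule convex_hull_vertices[OF h])
  have "gorenstein_of_index r \<Delta>"
    unfolding \<Delta>_image
  proof (rule gorenstein_of_index_affine_image[OF p r _ \<Delta>(4) W_int W_inv])
    show "int CARD('n) + 1 = r * int p" using assms(10) d by simp
    show "real p *\<^sub>R x \<in> int_lattice" if x: "W *v x \<in> int_lattice" for x
    proof -
      obtain c :: "nat \<Rightarrow> int" where
        c: "x - (\<Sum>i\<in>{1..l}. of_int (c i) *\<^sub>R G i) \<in> int_lattice" (is "?y \<in> _")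
        using x W_iff by blast
      have "real p *\<^sub>R x = real p *\<^sub>R ?y + (\<Sum>i\<in>{1..l}. of_int (c i) *\<^sub>R (real p *\<^sub>R G i))"
        by (simp add: scaleR_right_diff_distrib scaleR_sum_right mult.commute)
      also have "\<dots> \<in> int_lattice"
        by (intro int_lattice_add int_lattice_sum int_lattice_scaleR[OF _ c] int_lattice_scaleR[OF _ pG]) auto
      finally show ?thesis .
    qed
    have "(\<chi> j. 1 / real p) - (\<Sum>i\<in>{1..l}. of_int 1 *\<^sub>R G i) \<in> int_lattice"
      using sum_gen_lift[OF p s \<open>s l = d\<close> \<open>0 < l\<close> assms(11) h_range]
      by (simp add: int_lattice_def G_def)
    then show "W *v (\<chi> j. 1 / real p) \<in> int_lattice"
      unfolding W_iff by (rule exI[of _ "\<lambda>_. 1"])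
  qed simp
  moreover have "normalized_volume \<Delta> = real (p ^ l)"
  proof -
    \<comment> \<open>The pivot coordinates, and the generator that belongs to each of them.\<close>
    define S where "S = h -` (s ` {1..l})"
    define \<tau> where "\<tau> = inv_into {1..l} s \<circ> h"
    have "range h = {1..d}"
      using h d by (simp add: bij_betw_def)
    then have "h ` S = s ` {1..l}"
      unfolding S_def image_vimage_eq using s_range by (simp only: Int_absorb2)
    then have "bij_betw h S (s ` {1..l})"
      by (rule bij_betw_subset[OF h subset_UNIV])
    moreover have "bij_betw (inv_into {1..l} s) (s ` {1..l}) {1..l}"
      using inj_s by (intro bij_betw_inv_into) (simp add: bij_betw_def)
    ultimately have \<tau>: "bij_betw \<tau> S {1..l}"
      unfolding \<tau>_def by (rule bij_betw_trans)
    have s_\<tau>: "s (\<tau> j) = h j" if "j \<in> S" for j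
      using that by (simp add: \<tau>_def S_def f_inv_into_f)
    have \<tau>_range: "\<tau> j \<in> {1..l}" if "j \<in> S" for j
      using \<tau> that by (auto dest: bij_betwE)
    have "\<bar>det W\<bar> = real p ^ card S"
    proof (rule abs_det_eq_lattice_index[OF p W_inv W_int, where g = "\<lambda>j. G (\<tau> j)"])
      show "W *v G (\<tau> j) \<in> int_lattice" if "j \<in> S" for j
        using WG \<tau>_range that by blast
      show "G (\<tau> j) $ k = (if k = j then 1 / real p else 0)" if "j \<in> S" "k \<in> S" for j k
      proof -
        have "G (\<tau> j) $ k = gen_lift p s a (\<tau> j) (s (\<tau> k))"
          using that by (simp add: G_def s_\<tau>)
        also have "\<dots> = (if \<tau> k = \<tau> j then 1 / real p else 0)"
          using that \<tau>_range by (intro gen_lift_pivot[OF s]) auto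
        also have "\<tau> k = \<tau> j \<longleftrightarrow> k = j"
          using \<tau> that by (auto simp: bij_betw_def inj_on_def)
        finally show ?thesis .
      qed
      show "\<exists>c :: 'n \<Rightarrow> int. x - (\<Sum>j\<in>S. of_int (c j) *\<^sub>R G (\<tau> j)) \<in> int_lattice"
        if x: "W *v x \<in> int_lattice" for x
      proof -
        obtain c :: "nat \<Rightarrow> int" where "x - (\<Sum>i\<in>{1..l}. of_int (c i) *\<^sub>R G i) \<in> int_lattice"
          using x W_iff by blast
        then show ?thesis
          by (intro exI[of _ "c \<circ> \<tau>"])
            (simp only: o_apply sum.reindex_bij_betw[OF \<tau>, of "\<lambda>i. of_int (c i) *\<^sub>R G i"])
      qed
    qed (rule pG)
    moreover have "card S = l"
      using bij_betw_same_card[OF \<tau>] by simp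
    moreover have "measure lebesgue \<Delta> = measure lborel \<Delta>"
      unfolding \<Delta>(1)
      by (intro measure_completion)
        (auto intro!: borel_closed compact_imp_closed finite_imp_compact_convex_hull)
    moreover have "measure lborel \<Delta> = \<bar>det W\<bar> / fact CARD('n)"
      using content_simplex_vertices[OF h \<Delta>(2)]
      by (simp add: \<Delta>(1)[symmetric] W_def edge_matrix_def)
    ultimately show ?thesis
      by (simp add: normalized_volume_def)
  qed
  ultimately show ?thesis by blast
qed

end
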